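(* For every integer $n\ge 1$ and every integer $k$ with $0\le k\le 2n$, we have $s_{n,k}=z_{2n,k}$.
   Context: A 0-1-2 sum with $n$ summands is a sequence $(e_1,\dots,e_n)$ with each $e_i\in\{0,1,2\}$ such that whenever $e_i=2$ and $i<n$ we have $e_{i+1}\neq 0$. Its value is $e_1+\dots+e_n$. $s_{n,k}$ is the number of 0-1-2 sums with $n$ summands and value $k$. The fence $Z_{2n}$ is the directed graph with vertices $u_1,\dots,u_n$ and $v_1,\dots,v_n$. Its arcs are $u_i\to v_i$ for $1\le i\le n$ and $u_i\to v_{i+1}$ for $1\le i\le n-1$. A vertex set $A$ is closed if for every arc $x\to y$ with $x\in A$ we also have $y\in A$. $z_{2n,k}$ is the number of $k$-element closed sets of $Z_{2n}$. *)

theory Defs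
  imports Main "Graph_Theory.Pair_Digraph"
begin

text \<open>Lists are indexed from 0: the summand \<open>e\<^sub>i\<close> is \<open>es ! (i - 1)\<close>.\<close>

definition sum012 :: "nat list \<Rightarrow> bool" where
  "sum012 es \<longleftrightarrow> set es \<subseteq> {0, 1, 2} \<and>
     (\<forall>i. Suc i < length es \<longrightarrow> es ! i = 2 \<longrightarrow> es ! Suc i \<noteq> 0)"

definition s012 :: "nat \<Rightarrow> nat \<Rightarrow> nat" where
  "s012 n k = card {es. sum012 es \<and> length es = n \<and> sum_list es = k}"

datatype fence_vertex = U nat | V nat

text \<open>The argument \<open>n\<close> is half the number of vertices: \<open>fence n\<close> is \<open>Z\<^bsub>2n\<^esub>\<close>.\<close>

definition fence :: "nat \<Rightarrow> fence_vertex pair_pre_digraph" where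
  "fence n = \<lparr>
     pverts = U ` {1..n} \<union> V ` {1..n},
     parcs = {(U i, V i) | i. 1 \<le> i \<and> i \<le> n} \<union> {(U i, V (i + 1)) | i. 1 \<le> i \<and> i < n} \<rparr>"

definition closed_set :: "'a pair_pre_digraph \<Rightarrow> 'a set \<Rightarrow> bool" where
  "closed_set G A \<longleftrightarrow> A \<subseteq> pverts G \<and> (\<forall>(x, y) \<in> parcs G. x \<in> A \<longrightarrow> y \<in> A)"

definition num_closed_sets :: "'a pair_pre_digraph \<Rightarrow> nat \<Rightarrow> nat" where
  "num_closed_sets G k = card {A. closed_set G A \<and> card A = k}"

text \<open>All cardinalities above are taken of finite sets.\<close>

lemma finite_sums012: "finite {es. sum012 es \<and> length es = n \<and> sum_list es = k}"
  by (rule finite_subset[OF _ finite_lists_length_eq[of "{0, 1, 2}" n]])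
     (auto simp: sum012_def)

lemma pair_digraph_fence: "pair_digraph (fence n)"
proof
  have "parcs (fence n) \<subseteq> pverts (fence n) \<times> pverts (fence n)"
    by (auto simp: fence_def)
  then show "finite (parcs (fence n))"
    by (rule finite_subset) (simp add: fence_def)
qed (auto simp: fence_def)

lemma card_pverts_fence: "card (pverts (fence n)) = 2 * n"
proof -
  have "card (U ` {1..n} \<union> V ` {1..n}) = card (U ` {1..n}) + card (V ` {1..n})"
    by (rule card_Un_disjoint) auto
  then show ?thesis
    by (simp add: fence_def card_image inj_on_def)
qed

lemma finite_closed_sets:
  "finite (pverts G) \<Longrightarrow> finite {A. closed_set G A \<and> card A = k}"
  by (rule finite_subset[of _ "Pow (pverts G)"]) (auto simp: closed_set_def)

end

theory Submission
  imports Defs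
begin

text \<open>
  In a closed set \<open>A\<close> of the fence, \<open>u\<^sub>i \<in> A\<close> forces \<open>v\<^sub>i \<in> A\<close>, so \<open>A\<close> is determined by the
  numbers \<open>e\<^sub>i = |A \<inter> {u\<^sub>i, v\<^sub>i}|\<close>: \<open>u\<^sub>i \<in> A\<close> iff \<open>e\<^sub>i = 2\<close>, and \<open>v\<^sub>i \<in> A\<close> iff \<open>e\<^sub>i \<noteq> 0\<close>. The arcs
  \<open>u\<^sub>i \<rightarrow> v\<^bsub>i+1\<^esub>\<close> then say exactly that \<open>e\<^sub>i = 2\<close> implies \<open>e\<^bsub>i+1\<^esub> \<noteq> 0\<close>.
\<close>

definition column_counts :: "nat \<Rightarrow> fence_vertex set \<Rightarrow> nat list" where
  "column_counts n A = map (\<lambda>i. of_bool (U (Suc i) \<in> A) + of_bool (V (Suc i) \<in> A)) [0..<n]"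

definition set_of_counts :: "nat list \<Rightarrow> fence_vertex set" where
  "set_of_counts es =
     (\<lambda>i. U (Suc i)) ` {i. i < length es \<and> es ! i = 2} \<union>
     (\<lambda>i. V (Suc i)) ` {i. i < length es \<and> es ! i \<noteq> 0}"

lemma U_in_set_of_counts:
  "U j \<in> set_of_counts es \<longleftrightarrow> (\<exists>i. j = Suc i \<and> i < length es \<and> es ! i = 2)"
  by (auto simp: set_of_counts_def)

lemma V_in_set_of_counts:
  "V j \<in> set_of_counts es \<longleftrightarrow> (\<exists>i. j = Suc i \<and> i < length es \<and> es ! i \<noteq> 0)"
  by (auto simp: set_of_counts_def)

lemma U_in_fence: "U j \<in> pverts (fence n) \<longleftrightarrow> (\<exists>i. j = Suc i \<and> i < n)"
  by (cases j) (auto simp: fence_def)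

lemma V_in_fence: "V j \<in> pverts (fence n) \<longleftrightarrow> (\<exists>i. j = Suc i \<and> i < n)"
  by (cases j) (auto simp: fence_def)

text \<open>Shifting vertex indices down by 1 matches arcs with list positions: the second family
  then ranges over exactly those \<open>i\<close> that have a next position.\<close>

lemma parcs_fence:
  "parcs (fence n) = {(U (Suc i), V (Suc i)) | i. i < n} \<union>
     {(U (Suc i), V (Suc (Suc i))) | i. Suc i < n}"
proof -
  have "\<exists>j. i = Suc j \<and> j < n" if "1 \<le> i" "i \<le> n" for i
    using that by (cases i) auto
  moreover have "\<exists>j. i = Suc j \<and> Suc j < n" if "1 \<le> i" "i < n" for i
    using that by (cases i) auto
  ultimately show ?thesis
    by (fastforce simp: fence_def)
qed

lemma closed_set_fence_iff:
  "closed_set (fence n) A \<longleftrightarrow> A \<subseteq> pverts (fence n) \<and>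
     (\<forall>i<n. U (Suc i) \<in> A \<longrightarrow> V (Suc i) \<in> A) \<and>
     (\<forall>i. Suc i < n \<longrightarrow> U (Suc i) \<in> A \<longrightarrow> V (Suc (Suc i)) \<in> A)"
  unfolding closed_set_def parcs_fence by blast

lemma sum012_nth: "sum012 es \<Longrightarrow> i < length es \<Longrightarrow> es ! i \<in> {0, 1, 2}"
  unfolding sum012_def using nth_mem by blast

lemma sum012_column_counts:
  assumes "closed_set (fence n) A"
  shows "sum012 (column_counts n A)"
  using assms by (auto simp: sum012_def column_counts_def closed_set_fence_iff)

text \<open>Arcs inside a column are respected because 2 is nonzero, arcs to the next column because
  of the adjacency condition in \<open>sum012\<close>.\<close>

lemma closed_set_set_of_counts:
  assumes "sum012 es"
  shows "closed_set (fence (length es)) (set_of_counts es)"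
proof -
  have "x \<in> pverts (fence (length es))" if "x \<in> set_of_counts es" for x
    using that
    by (cases x) (auto simp: U_in_set_of_counts V_in_set_of_counts U_in_fence V_in_fence)
  then show ?thesis
    using assms
    by (auto simp: sum012_def closed_set_fence_iff U_in_set_of_counts V_in_set_of_counts)
qed

text \<open>The bound on the entries matters: an entry 3 would contribute only its \<open>V\<close>
  vertex and come back as 1.\<close>

lemma column_counts_set_of_counts:
  assumes "sum012 es"
  shows "column_counts (length es) (set_of_counts es) = es"
proof (rule nth_equalityI)
  fix i
  assume "i < length (column_counts (length es) (set_of_counts es))"
  then show "column_counts (length es) (set_of_counts es) ! i = es ! i"
    using sum012_nth[OF assms, of i]
    by (auto simp: column_counts_def U_in_set_of_counts V_in_set_of_counts)
qed (simp add: column_counts_def)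

text \<open>A count of 1 could come from either vertex of a column; the arc inside the column rules
  out a \<open>U\<close> vertex alone.\<close>

lemma set_of_counts_column_counts:
  assumes "closed_set (fence n) A"
  shows "set_of_counts (column_counts n A) = A"
proof (rule set_eqI)
  fix x
  have sub: "A \<subseteq> pverts (fence n)"
    and UV: "\<And>i. i < n \<Longrightarrow> U (Suc i) \<in> A \<Longrightarrow> V (Suc i) \<in> A"
    using assms by (auto simp: closed_set_fence_iff)
  \<comment> \<open>\<open>column_counts\<close> sees only columns 1 to \<open>n\<close>; no vertex
    of \<open>A\<close> lies outside them.\<close>
  have U: "\<exists>i. j = Suc i \<and> i < n" if "U j \<in> A" for j
    using subsetD[OF sub that] by (simp add: U_in_fence)
  have V: "\<exists>i. j = Suc i \<and> i < n" if "V j \<in> A" for j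
    using subsetD[OF sub that] by (simp add: V_in_fence)
  show "x \<in> set_of_counts (column_counts n A) \<longleftrightarrow> x \<in> A"
    using U UV V
    by (cases x) (fastforce simp: column_counts_def U_in_set_of_counts V_in_set_of_counts
        of_bool_def split: if_splits)+
qed

text \<open>Double counting: \<open>A\<close> splits by vertex kind into two disjoint parts, and
  adding their indicators column by column gives the list entries.\<close>

lemma sum_list_column_counts:
  assumes "A \<subseteq> pverts (fence n)"
  shows "sum_list (column_counts n A) = card A"
proof -
  let ?I = "{i. i < n \<and> U (Suc i) \<in> A}" and ?J = "{i. i < n \<and> V (Suc i) \<in> A}"
  have "x \<in> (\<lambda>i. U (Suc i)) ` ?I \<union> (\<lambda>i. V (Suc i)) ` ?J" if "x \<in> A" for x
    using that subsetD[OF assms that] by (cases x) (auto simp: U_in_fence V_in_fence)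
  then have "A = (\<lambda>i. U (Suc i)) ` ?I \<union> (\<lambda>i. V (Suc i)) ` ?J"
    by auto
  then have "card A = card ((\<lambda>i. U (Suc i)) ` ?I \<union> (\<lambda>i. V (Suc i)) ` ?J)"
    by (rule arg_cong)
  also have "\<dots> = card ((\<lambda>i. U (Suc i)) ` ?I) + card ((\<lambda>i. V (Suc i)) ` ?J)"
    by (rule card_Un_disjoint) auto
  also have "\<dots> = card ?I + card ?J"
    by (simp add: card_image inj_on_def)
  also have "\<dots> = (\<Sum>i<n. of_bool (U (Suc i) \<in> A)) + (\<Sum>i<n. of_bool (V (Suc i) \<in> A))"
    by (simp add: sum_of_bool_eq Int_def)
  also have "\<dots> = sum_list (column_counts n A)"
    by (simp add: column_counts_def interv_sum_list_conv_sum_set_nat sum.distrib atLeast0LessThan)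
  finally show ?thesis ..
qed

theorem theorem4:
  fixes n k :: nat
  assumes "n \<ge> 1" and "k \<le> 2 * n"
  shows "s012 n k = num_closed_sets (fence n) k"
proof -
  let ?S = "{es. sum012 es \<and> length es = n \<and> sum_list es = k}"
  let ?Z = "{A. closed_set (fence n) A \<and> card A = k}"
  \<comment> \<open>The constructed set is closed, so its size is the sum of its column counts, and
    these are \<open>es\<close> again.\<close>
  have card_set: "card (set_of_counts es) = sum_list es" if "sum012 es" for es
    using that closed_set_set_of_counts[OF that] sum_list_column_counts
      column_counts_set_of_counts[OF that] by (metis closed_set_def)
  have "bij_betw set_of_counts ?S ?Z"
  proof (rule bij_betw_byWitness[where f' = "column_counts n"])
    show "\<forall>es\<in>?S. column_counts n (set_of_counts es) = es"
      using column_counts_set_of_counts by auto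
    show "\<forall>A\<in>?Z. set_of_counts (column_counts n A) = A"
      using set_of_counts_column_counts by auto
    show "set_of_counts ` ?S \<subseteq> ?Z"
      using closed_set_set_of_counts card_set by auto
    show "column_counts n ` ?Z \<subseteq> ?S"
      using sum012_column_counts sum_list_column_counts
      by (auto simp: closed_set_def column_counts_def)
  qed
  then show ?thesis
    unfolding s012_def num_closed_sets_def by (rule bij_betw_same_card)
qed

end
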